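(* Let $d\ge 1$ and let $\Lambda_d\subset\mathbb{R}^d$ be a Gatzouras--Lalley sponge (as defined in the context). Then the box dimension of $\Lambda_d$ exists and $$\dim_{\mathrm B}\Lambda_d = s_d,$$ where the numbers $s_1\le s_2\le\ldots\le s_d$ are defined, successively, as the unique solutions to the equations $$\sum_{i\in\mathcal{I}_1}(\lambda(i))^{s_1}=1\quad\text{and}\quad \sum_{\underline{i}\in\mathcal{I}_n}\big(\lambda(\underline{i}^{(1)})\big)^{s_1}\cdot\prod_{\ell=2}^{n}\big(\lambda(\underline{i}^{(\ell)})\big)^{s_\ell-s_{\ell-1}}=1\ \text{ for } n=2,\ldots,d.$$
   Context: Box dimension: for bounded $\Lambda\subset\mathbb{R}^d$, $\dim_{\mathrm B}\Lambda=\lim_{\delta\to0}\frac{\log N_\delta(\Lambda)}{-\log\delta}$ (when the limit exists), where $N_\delta(\Lambda)$ is the minimum number of $d$-dimensional boxes of sidelength $\delta$ needed to cover $\Lambda$. Index sets: fix an integer $N\ge2$ and let $\mathcal{I}_1=\{1,\ldots,N\}$. Inductively for $2\le n\le d$: given $\mathcal{I}_{n-1}$, fix a positive integer $N(\underline{i})$ for each $\underline{i}\in\mathcal{I}_{n-1}$, let $\mathcal{I}(\underline{i})=\{1,\ldots,N(\underline{i})\}$ and $\mathcal{I}_n=\{(\underline{i},i_n):\underline{i}\in\mathcal{I}_{n-1},\ i_n\in\mathcal{I}(\underline{i})\}$. For $\underline{i}=(i_1,\ldots,i_n)\in\mathcal{I}_n$ and $\ell\le n$ write $\underline{i}^{(\ell)}=(i_1,\ldots,i_\ell)\in\mathcal{I}_\ell$.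 Iterated function systems: for every $1\le n\le d$ and $\underline{i}\in\mathcal{I}_n$ numbers $0<\lambda(\underline{i})<1$ and $t(\underline{i})\in\mathbb{R}$ are given. For $1\le n\le d$ let $\mathcal{S}_n=\{S_{\underline{i}}:\mathbb{R}^n\to\mathbb{R}^n\}_{\underline{i}\in\mathcal{I}_n}$ with $$S_{\underline{i}}(\underline{x})=\mathrm{diag}\big(\lambda(\underline{i}^{(1)}),\ldots,\lambda(\underline{i}^{(n)})\big)\,\underline{x}+\big(t(\underline{i}^{(1)}),\ldots,t(\underline{i}^{(n)})\big)^{T}.$$ It is assumed that $S_{\underline{i}}([0,1]^n)\subset[0,1]^n$. The attractor $\Lambda_n$ is the unique non-empty compact set with $\Lambda_n=\bigcup_{\underline{i}\in\mathcal{I}_n}S_{\underline{i}}(\Lambda_n)$. Gatzouras--Lalley sponge: $\Lambda_d$ is a Gatzouras--Lalley sponge if (1) (cuboidal open set condition) for every $1\le n\le d$, $S_{\underline{i}}((0,1)^n)\cap S_{\underline{j}}((0,1)^n)=\emptyset$ for all $\underline{i}\ne\underline{j}\in\mathcal{I}_n$; (2) (coordinate ordering condition) $0<\lambda(\underline{i}^{(d)})<\lambda(\underline{i}^{(d-1)})<\ldots<\lambda(\underline{i}^{(1)})<1$ for every $\underline{i}\in\mathcal{I}_d$. *)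

theory Defs
  imports "HOL-Analysis.Analysis"
begin

text \<open>
  The space \<open>\<real>\<^sup>n\<close> is \<^term>\<open>Euclidean_space n\<close>: its points are the sequences \<open>x\<close> of reals with
  \<open>x k = 0\<close> for \<open>k \<ge> n\<close>, so the coordinate \<open>x\<^sub>l\<close> (\<open>1 \<le> l \<le> n\<close>) of the usual notation is
  \<open>x (l - 1)\<close>.

  A symbol \<open>(i\<^sub>1, \<dots>, i\<^sub>n)\<close> is the list \<open>[i\<^sub>1, \<dots>, i\<^sub>n]\<close>, and its truncation to the first \<open>l\<close>
  entries is \<^term>\<open>take l i\<close>. The numbers of children are given by a function \<open>N\<close> on lists, where
  \<open>N []\<close> is the number of symbols of length one. The contraction ratios \<open>lam\<close> and the translations
  \<open>t\<close> are functions on lists as well; their values, and those of \<open>N\<close>, matter only on the index sets.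
\<close>

fun index_set :: "(nat list \<Rightarrow> nat) \<Rightarrow> nat \<Rightarrow> nat list set" where
  "index_set N 0 = {[]}"
| "index_set N (Suc n) = {i @ [j] | i j. i \<in> index_set N n \<and> j \<in> {1..N i}}"

definition sponge_map ::
    "(nat list \<Rightarrow> real) \<Rightarrow> (nat list \<Rightarrow> real) \<Rightarrow> nat list \<Rightarrow> (nat \<Rightarrow> real) \<Rightarrow> (nat \<Rightarrow> real)" where
  "sponge_map lam t i x =
     (\<lambda>k. if k < length i then lam (take (Suc k) i) * x k + t (take (Suc k) i) else 0)"

definition closed_unit_cube :: "nat \<Rightarrow> (nat \<Rightarrow> real) set" where
  "closed_unit_cube n = {x \<in> topspace (Euclidean_space n). \<forall>k<n. 0 \<le> x k \<and> x k \<le> 1}"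

definition open_unit_cube :: "nat \<Rightarrow> (nat \<Rightarrow> real) set" where
  "open_unit_cube n = {x \<in> topspace (Euclidean_space n). \<forall>k<n. 0 < x k \<and> x k < 1}"

definition sponge_IFS ::
    "nat \<Rightarrow> (nat list \<Rightarrow> nat) \<Rightarrow> (nat list \<Rightarrow> real) \<Rightarrow> (nat list \<Rightarrow> real) \<Rightarrow> bool" where
  "sponge_IFS d N lam t \<longleftrightarrow>
     N [] \<ge> 2 \<and>
     (\<forall>n\<in>{1..<d}. \<forall>i\<in>index_set N n. N i \<ge> 1) \<and>
     (\<forall>n\<in>{1..d}. \<forall>i\<in>index_set N n. 0 < lam i \<and> lam i < 1) \<and>
     (\<forall>n\<in>{1..d}. \<forall>i\<in>index_set N n. sponge_map lam t i ` closed_unit_cube n \<subseteq> closed_unit_cube n)"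

definition is_attractor ::
    "nat \<Rightarrow> (nat list \<Rightarrow> nat) \<Rightarrow> (nat list \<Rightarrow> real) \<Rightarrow> (nat list \<Rightarrow> real) \<Rightarrow> (nat \<Rightarrow> real) set \<Rightarrow> bool"
  where
  "is_attractor n N lam t K \<longleftrightarrow>
     K \<noteq> {} \<and> compactin (Euclidean_space n) K \<and>
     K = (\<Union>i\<in>index_set N n. sponge_map lam t i ` K)"

definition cuboidal_open_set_condition ::
    "nat \<Rightarrow> (nat list \<Rightarrow> nat) \<Rightarrow> (nat list \<Rightarrow> real) \<Rightarrow> (nat list \<Rightarrow> real) \<Rightarrow> bool" where
  "cuboidal_open_set_condition d N lam t \<longleftrightarrow>
     (\<forall>n\<in>{1..d}. \<forall>i\<in>index_set N n. \<forall>j\<in>index_set N n. i \<noteq> j \<longrightarrow>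
        sponge_map lam t i ` open_unit_cube n \<inter> sponge_map lam t j ` open_unit_cube n = {})"

text \<open>
  The outer bounds \<open>0 < lam (take d i)\<close> and \<open>lam (take 1 i) < 1\<close> of the chain of inequalities are
  part of \<^const>\<open>sponge_IFS\<close>.
\<close>

definition coordinate_ordering_condition ::
    "nat \<Rightarrow> (nat list \<Rightarrow> nat) \<Rightarrow> (nat list \<Rightarrow> real) \<Rightarrow> bool" where
  "coordinate_ordering_condition d N lam \<longleftrightarrow>
     (\<forall>i\<in>index_set N d. \<forall>l\<in>{1..<d}. lam (take (Suc l) i) < lam (take l i))"

definition gatzouras_lalley_sponge ::
    "nat \<Rightarrow> (nat list \<Rightarrow> nat) \<Rightarrow> (nat list \<Rightarrow> real) \<Rightarrow> (nat list \<Rightarrow> real) \<Rightarrow> (nat \<Rightarrow> real) set \<Rightarrow> bool"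
  where
  "gatzouras_lalley_sponge d N lam t K \<longleftrightarrow>
     sponge_IFS d N lam t \<and> is_attractor d N lam t K \<and>
     cuboidal_open_set_condition d N lam t \<and> coordinate_ordering_condition d N lam"

text \<open>
  Boxes are closed and axis-parallel. In \<open>covering_number\<close> the requirement \<^term>\<open>finite C\<close> is
  essential, since infinite sets have \<^const>\<open>card\<close> zero; a finite cover exists for every bounded set.
\<close>

definition coordinate_box :: "nat \<Rightarrow> real \<Rightarrow> (nat \<Rightarrow> real) \<Rightarrow> (nat \<Rightarrow> real) set" where
  "coordinate_box d \<delta> a =
     {x \<in> topspace (Euclidean_space d). \<forall>k<d. a k \<le> x k \<and> x k \<le> a k + \<delta>}"

definition covering_number :: "nat \<Rightarrow> real \<Rightarrow> (nat \<Rightarrow> real) set \<Rightarrow> nat" where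
  "covering_number d \<delta> K =
     (LEAST m. \<exists>C. finite C \<and> card C = m \<and>
        C \<subseteq> coordinate_box d \<delta> ` topspace (Euclidean_space d) \<and> K \<subseteq> \<Union>C)"

definition has_box_dimension :: "nat \<Rightarrow> (nat \<Rightarrow> real) set \<Rightarrow> real \<Rightarrow> bool" where
  "has_box_dimension d K s \<longleftrightarrow>
     K \<subseteq> topspace (Euclidean_space d) \<and> (\<exists>R. \<forall>x\<in>K. \<forall>k<d. \<bar>x k\<bar> \<le> R) \<and>
     ((\<lambda>\<delta>. ln (real (covering_number d \<delta> K)) / (- ln \<delta>)) \<longlongrightarrow> s) (at_right 0)"

text \<open>
  The left-hand side of the \<open>n\<close>-th defining equation. It depends only on \<open>s 1, \<dots>, s n\<close>; for
  \<open>n = 1\<close> the product is empty.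
\<close>

definition dimension_sum ::
    "(nat list \<Rightarrow> nat) \<Rightarrow> (nat list \<Rightarrow> real) \<Rightarrow> (nat \<Rightarrow> real) \<Rightarrow> nat \<Rightarrow> real" where
  "dimension_sum N lam s n =
     (\<Sum>i\<in>index_set N n. lam (take 1 i) powr s 1 *
        (\<Prod>l=2..n. lam (take l i) powr (s l - s (l - 1))))"

text \<open>
  \<open>s 1, \<dots>, s d\<close> are, successively, the unique solutions: for fixed \<open>s 1, \<dots>, s (n - 1)\<close> the \<open>n\<close>-th
  equation has exactly one real solution, namely \<open>s n\<close>.
\<close>

definition successive_unique_solutions ::
    "nat \<Rightarrow> (nat list \<Rightarrow> nat) \<Rightarrow> (nat list \<Rightarrow> real) \<Rightarrow> (nat \<Rightarrow> real) \<Rightarrow> bool" where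
  "successive_unique_solutions d N lam s \<longleftrightarrow>
     (\<forall>n\<in>{1..d}. dimension_sum N lam s n = 1 \<and> (\<exists>!u. dimension_sum N lam (s(n := u)) n = 1))"

end

theory Submission
  imports Defs
begin

text \<open>
  Write \<open>e\<^sub>l = s\<^sub>l - s\<^sub>l\<^sub>-\<^sub>1 \<ge> 0\<close> and subdivide the unit cube at scale \<open>\<delta>\<close>: a cuboid whose
  sides \<open>r\<^sub>1 \<ge> \<dots> \<ge> r\<^sub>m\<close> exceed \<open>\<delta>\<close>, while the remaining ones have length comparable to \<open>\<delta>\<close>, is
  replaced by its images under the maps of \<open>\<I>\<^sub>m\<close> in the first \<open>m\<close> coordinates. By the coordinate
  ordering the long sides always form an initial segment, and the \<open>m\<close>-th defining equation says
  that the weight \<open>\<Prod> r\<^sub>l\<^bsup>e\<^sub>l\<^esup>\<close> is additive under a subdivision step. The terminal cuboids (the approximate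
  squares) have weight comparable to \<open>\<delta>\<^bsup>s\<^sub>d\<^esup>\<close>, and the weights sum up to 1, so there are about \<open>\<delta>\<^bsup>-s\<^sub>d\<^esup>\<close>
  of them. Each is covered by one box. Conversely each contains a point of the attractor, and by the
  open set condition only boundedly many of them fit into a box of side \<open>3\<delta>\<close>.
\<close>

section \<open>Sums over the index sets\<close>

declare index_set.simps(2) [simp del]

lemma snoc_in_index_set [simp]:
  "i @ [j] \<in> index_set N (Suc n) \<longleftrightarrow> i \<in> index_set N n \<and> j \<in> {1..N i}"
  by (auto simp: index_set.simps(2))

lemma index_set_SucE:
  assumes "i \<in> index_set N (Suc n)"
  obtains i' j where "i = i' @ [j]" "i' \<in> index_set N n" "j \<in> {1..N i'}"
  using assms by (auto simp: index_set.simps(2))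

lemma length_index_set: "i \<in> index_set N n \<Longrightarrow> length i = n"
  by (induction n arbitrary: i) (auto elim: index_set_SucE)

lemma take_index_set: "i \<in> index_set N n \<Longrightarrow> k \<le> n \<Longrightarrow> take k i \<in> index_set N k"
proof (induction n arbitrary: i)
  case (Suc n)
  then obtain i' j where i: "i = i' @ [j]" "i' \<in> index_set N n" by (auto elim: index_set_SucE)
  show ?case
  proof (cases "k = Suc n")
    case True
    then show ?thesis using Suc.prems length_index_set[OF Suc.prems(1)] by simp
  next
    case False
    then show ?thesis using Suc i length_index_set[OF i(2)] by simp
  qed
qed simp

lemma index_set_Suc_eq:
  "index_set N (Suc n) = (\<lambda>(i, j). i @ [j]) ` (SIGMA i:index_set N n. {1..N i})"
  by (auto simp: index_set.simps(2))

lemma finite_index_set: "finite (index_set N n)"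
  by (induction n) (auto simp: index_set_Suc_eq)

lemma sum_index_set_Suc:
  "(\<Sum>i\<in>index_set N (Suc n). f i) = (\<Sum>i\<in>index_set N n. \<Sum>j\<in>{1..N i}. f (i @ [j]))"
proof -
  have "inj_on (\<lambda>(i, j). i @ [j]) (SIGMA i:index_set N n. {1..N i})"
    by (auto simp: inj_on_def)
  then show ?thesis
    by (simp only: index_set_Suc_eq sum.reindex)
      (simp add: sum.Sigma finite_index_set case_prod_unfold)
qed

lemma prod_take_snoc:
  assumes "i \<in> index_set N n"
  shows "(\<Prod>l<Suc n. g l (take (Suc l) (i @ [j]))) =
    (\<Prod>l<n. g l (take (Suc l) i)) * (g n (i @ [j]) :: 'a :: comm_monoid_mult)"
  using length_index_set[OF assms] by simp

text \<open>The index sets are trees rather than products. Summing over the last symbol first still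
  peels off one factor at a time, because the bound \<open>F k\<close> is the same for every parent
  \<open>i\<close>.\<close>

lemma sum_index_set_prod_le:
  fixes g :: "nat \<Rightarrow> nat list \<Rightarrow> real"
  assumes "\<And>k i. g k i \<ge> 0"
    and "\<And>k. k < m \<Longrightarrow> F k \<ge> 0"
    and "\<And>k i. k < m \<Longrightarrow> i \<in> index_set N k \<Longrightarrow> (\<Sum>j\<in>{1..N i}. g k (i @ [j])) \<le> F k"
  shows "(\<Sum>i\<in>index_set N m. \<Prod>l<m. g l (take (Suc l) i)) \<le> (\<Prod>l<m. F l)"
  using assms(2,3)
proof (induction m)
  case (Suc m)
  have "(\<Sum>i\<in>index_set N (Suc m). \<Prod>l<Suc m. g l (take (Suc l) i)) =
      (\<Sum>i\<in>index_set N m. (\<Prod>l<m. g l (take (Suc l) i)) * (\<Sum>j\<in>{1..N i}. g m (i @ [j])))"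
    unfolding sum_index_set_Suc sum_distrib_left
    by (intro sum.cong refl prod_take_snoc)
  also have "\<dots> \<le> (\<Sum>i\<in>index_set N m. (\<Prod>l<m. g l (take (Suc l) i)) * F m)"
    using Suc.prems by (intro sum_mono mult_left_mono prod_nonneg ballI assms(1)) auto
  also have "\<dots> \<le> (\<Prod>l<m. F l) * F m"
    unfolding sum_distrib_right[symmetric]
    using Suc by (intro mult_right_mono Suc.IH) auto
  finally show ?case by simp
qed simp

section \<open>Exponents and overlaps on the line\<close>

text \<open>As a function of the exponent the sum is continuous and strictly decreasing, is at least
  1 at 0 and tends to 0 at infinity. Uniqueness therefore holds among all reals, not only the
  nonnegative ones.\<close>

lemma unique_exponent:
  fixes c q :: "'a \<Rightarrow> real"
  assumes "finite A" "A \<noteq> {}" "\<And>i. i \<in> A \<Longrightarrow> c i > 0"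
    and q: "\<And>i. i \<in> A \<Longrightarrow> 0 < q i \<and> q i < 1"
    and ge: "(\<Sum>i\<in>A. c i) \<ge> 1"
  shows "\<exists>v\<ge>0. (\<Sum>i\<in>A. c i * q i powr v) = 1"
    and "(\<Sum>i\<in>A. c i * q i powr v) = 1 \<Longrightarrow> (\<Sum>i\<in>A. c i * q i powr w) = 1 \<Longrightarrow> v = w"
proof -
  let ?g = "\<lambda>v. \<Sum>i\<in>A. c i * q i powr v"
  have mono: "?g w < ?g v" if "v < w" for v w
    using assms that by (intro sum_strict_mono mult_strict_left_mono powr_less_mono') auto
  have cont: "continuous_on UNIV ?g"
    using q by (intro continuous_intros) fastforce
  have "(?g \<longlongrightarrow> (\<Sum>i\<in>A. c i * 0)) at_top"
  proof (intro tendsto_intros)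
    fix i assume "i \<in> A"
    then have "q i > 0" "q i < 1" using q by auto
    then have "filterlim (\<lambda>v. ln (q i) * v) at_bot at_top"
      by (intro filterlim_tendsto_neg_mult_at_bot[where c = "ln (q i)"] tendsto_const filterlim_ident) auto
    then have "((\<lambda>v. exp (ln (q i) * v)) \<longlongrightarrow> 0) at_top"
      by (rule filterlim_compose[OF exp_at_bot])
    then show "((\<lambda>v. q i powr v) \<longlongrightarrow> 0) at_top"
      using \<open>q i > 0\<close> by (simp add: powr_def mult.commute)
  qed
  from order_tendstoD(2)[OF this, of 1]
  have "eventually (\<lambda>v. 0 \<le> v \<and> ?g v < 1) at_top"
    using eventually_ge_at_top[of "0 :: real"] by (simp add: eventually_conj)
  then obtain b where b: "b \<ge> 0" "?g b < 1"
    using eventually_happens'[OF trivial_limit_at_top_linorder] by blast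
  have "?g 0 = (\<Sum>i\<in>A. c i)" using q by (intro sum.cong) force+
  then have "\<exists>v. 0 \<le> v \<and> v \<le> b \<and> ?g v = 1"
    using b ge continuous_on_subset[OF cont] IVT2'[of ?g b 1 0] by auto
  then show "\<exists>v\<ge>0. ?g v = 1" by blast
  show "?g v = 1 \<Longrightarrow> ?g w = 1 \<Longrightarrow> v = w"
    using mono[of v w] mono[of w v] by (cases v w rule: linorder_cases) auto
qed

text \<open>
  An interval of length at most \<open>\<delta>\<close> that meets \<open>{b..b + \<delta>}\<close> lies in \<open>{b - \<delta>..b + 2 * \<delta>}\<close>.
\<close>

definition overlap :: "real \<Rightarrow> real \<Rightarrow> real \<Rightarrow> real \<Rightarrow> real" where
  "overlap \<delta> a r b = measure lborel ({a<..<a + r} \<inter> {b - \<delta>..b + 2 * \<delta>})"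

lemma overlap_fmeasurable: "{a<..<a + r} \<inter> {b - \<delta>..b + 2 * \<delta>} \<in> fmeasurable (lborel :: real measure)"
  using fmeasurable_Int_fmeasurable[OF fmeasurable_box[of a "a + r"], of "cbox (b - \<delta>) (b + 2 * \<delta>)"]
  by simp

lemma overlap_nonneg: "overlap \<delta> a r b \<ge> 0"
  by (simp add: overlap_def)

lemma overlap_le: "0 < \<delta> \<Longrightarrow> overlap \<delta> a r b \<le> 3 * \<delta>"
proof -
  assume "0 < \<delta>"
  have "overlap \<delta> a r b \<le> measure lborel {b - \<delta>..b + 2 * \<delta>}"
    unfolding overlap_def
    using fmeasurable_cbox[of "b - \<delta>" "b + 2 * \<delta>"] by (intro measure_mono_fmeasurable) simp_all
  then show ?thesis using \<open>0 < \<delta>\<close> by simp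
qed

lemma overlap_full: "0 \<le> r \<Longrightarrow> b - \<delta> \<le> a \<Longrightarrow> a + r \<le> b + 2 * \<delta> \<Longrightarrow> overlap \<delta> a r b = r"
proof -
  assume *: "0 \<le> r" "b - \<delta> \<le> a" "a + r \<le> b + 2 * \<delta>"
  then have "{a<..<a + r} \<inter> {b - \<delta>..b + 2 * \<delta>} = {a<..<a + r}" by auto
  then show ?thesis using * by (simp add: overlap_def)
qed

text \<open>The map \<open>(x - a) / r\<close> takes the scaled intervals back to the disjoint
  subintervals of the unit interval, so the sum is the measure of a disjoint union inside
  \<open>{a<..<a + r}\<close>.\<close>

lemma sum_overlap_le:
  assumes "finite J" "0 < r"
    and sub: "\<And>j. j \<in> J \<Longrightarrow> {u j<..<u j + w j} \<subseteq> {0<..<1 :: real}"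
    and disj: "\<And>j k. j \<in> J \<Longrightarrow> k \<in> J \<Longrightarrow> j \<noteq> k \<Longrightarrow> {u j<..<u j + w j} \<inter> {u k<..<u k + w k} = {}"
  shows "(\<Sum>j\<in>J. overlap \<delta> (a + r * u j) (r * w j) b) \<le> overlap \<delta> a r b"
proof -
  define S where "S j = {a + r * u j<..<a + r * u j + r * w j} \<inter> {b - \<delta>..b + 2 * \<delta>}" for j
  have S: "(x - a) / r \<in> {u j<..<u j + w j}" if "x \<in> S j" for x j
    using that \<open>0 < r\<close> by (auto simp: S_def field_simps)
  have "disjoint_family_on S J"
    unfolding disjoint_family_on_def using S disj by blast
  then have "(\<Sum>j\<in>J. measure lborel (S j)) = measure lborel (\<Union>j\<in>J. S j)"
    using assms(1) fmeasurableD2[OF overlap_fmeasurable]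
    by (intro measure_finite_Union[symmetric]) (assumption | simp add: S_def image_subset_iff)+
  also have "\<dots> \<le> overlap \<delta> a r b"
    unfolding overlap_def
  proof (rule measure_mono_fmeasurable)
    show "(\<Union>j\<in>J. S j) \<subseteq> {a<..<a + r} \<inter> {b - \<delta>..b + 2 * \<delta>}"
    proof
      fix x assume "x \<in> (\<Union>j\<in>J. S j)"
      then obtain j where j: "j \<in> J" "x \<in> S j" by auto
      then have "(x - a) / r \<in> {0<..<1}" using S sub by blast
      then show "x \<in> {a<..<a + r} \<inter> {b - \<delta>..b + 2 * \<delta>}"
        using j \<open>0 < r\<close> by (auto simp: S_def field_simps)
    qed
  qed (auto simp: S_def overlap_fmeasurable assms(1))
  finally show ?thesis by (simp add: S_def overlap_def)
qed

section \<open>Subdivision into approximate squares\<close>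

locale sponge =
  fixes d :: nat and N :: "nat list \<Rightarrow> nat" and lam t :: "nat list \<Rightarrow> real"
    and K :: "(nat \<Rightarrow> real) set"
  assumes sponge: "gatzouras_lalley_sponge d N lam t K"
begin

abbreviation I :: "nat \<Rightarrow> nat list set" where
  "I \<equiv> index_set N"

section \<open>Consequences of the sponge conditions for single words\<close>

lemma lam_bounds:
  assumes "i \<in> I (Suc n)" "n < d"
  shows "0 < lam i" "lam i < 1"
  using sponge assms unfolding gatzouras_lalley_sponge_def sponge_IFS_def by auto

lemma lam_take_bounds:
  assumes "i \<in> I m" "m \<le> d" "l < m"
  shows "0 < lam (take (Suc l) i)" "lam (take (Suc l) i) < 1"
  using assms by (auto intro!: lam_bounds[of _ l] take_index_set simp: Suc_le_eq)

lemma N_pos: "i \<in> I n \<Longrightarrow> n < d \<Longrightarrow> N i \<ge> 1"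
  using sponge unfolding gatzouras_lalley_sponge_def sponge_IFS_def
  by (cases "n = 0") auto

text \<open>The ordering condition and the equation for \<open>K\<close> speak of words of length
  \<open>d\<close> only; extensions carry them over to shorter words.\<close>

lemma extend_index:
  assumes "i \<in> I m" "m \<le> n" "n \<le> d"
  shows "\<exists>i'\<in>I n. take m i' = i"
  using assms(2,3)
proof (induction n rule: dec_induct)
  case base
  then show ?case using assms(1) length_index_set[OF assms(1)] by (intro bexI[of _ i]) auto
next
  case (step n)
  then obtain i' where i': "i' \<in> I n" "take m i' = i" by auto
  then have "i' @ [1] \<in> I (Suc n)" using N_pos[OF i'(1)] step by auto
  then show ?case
    using i' step length_index_set[OF i'(1)] by (intro bexI[of _ "i' @ [1]"]) auto
qed

lemma index_set_nonempty: "n \<le> d \<Longrightarrow> I n \<noteq> {}"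
  using extend_index[of "[]" 0 n] by auto

lemma lam_ordered:
  assumes "i \<in> I m" "m \<le> d" "Suc l < m"
  shows "lam (take (Suc (Suc l)) i) < lam (take (Suc l) i)"
proof -
  obtain i' where i': "i' \<in> I d" "take m i' = i" using extend_index[of i m d] assms by auto
  then have "take (Suc (Suc l)) i = take (Suc (Suc l)) i'" "take (Suc l) i = take (Suc l) i'"
    using assms by (auto simp: min_def)
  then show ?thesis
    using sponge assms i'
    unfolding gatzouras_lalley_sponge_def coordinate_ordering_condition_def by auto
qed

lemma translation_bounds:
  assumes "i \<in> I (Suc n)" "n < d"
  shows "0 \<le> t i" "lam i + t i \<le> 1"
proof -
  have sub: "sponge_map lam t i ` closed_unit_cube (Suc n) \<subseteq> closed_unit_cube (Suc n)"
    using sponge assms unfolding gatzouras_lalley_sponge_def sponge_IFS_def by auto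
  have len: "length i = Suc n" using length_index_set assms by auto
  \<comment> \<open>Two opposite corners of the cube: the last coordinates of their images are
    \<open>t i\<close> and \<open>lam i + t i\<close>.\<close>
  have "(\<lambda>k. if k < Suc n then c else 0) \<in> closed_unit_cube (Suc n)" if "c = 0 \<or> c = 1" for c :: real
    using that by (auto simp: closed_unit_cube_def topspace_Euclidean_space)
  then have *: "sponge_map lam t i (\<lambda>k. if k < Suc n then c else 0) \<in> closed_unit_cube (Suc n)"
    if "c = 0 \<or> c = 1" for c :: real using that sub by blast
  show "0 \<le> t i" "lam i + t i \<le> 1"
    using *[of 0] *[of 1] len by (auto simp: closed_unit_cube_def sponge_map_def dest!: spec[of _ n])
qed

text \<open>The maps of two siblings agree in all coordinates but the last, so a common point of the
  two intervals would lift to a common point of the images of the open cube.\<close>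

lemma siblings_disjoint:
  assumes "i \<in> I n" "n < d" "j \<in> {1..N i}" "j' \<in> {1..N i}" "j \<noteq> j'"
  defines "p \<equiv> i @ [j]" and "p' \<equiv> i @ [j']"
  shows "{t p<..<t p + lam p} \<inter> {t p'<..<t p' + lam p'} = {}"
proof (rule ccontr)
  assume "\<not> ?thesis"
  then obtain x where x: "t p < x" "x < t p + lam p" "t p' < x" "x < t p' + lam p'"
    by (metis Int_iff equals0I greaterThanLessThan_iff)
  have len: "length i = n" using length_index_set assms by auto
  have pI: "p \<in> I (Suc n)" "p' \<in> I (Suc n)" using assms by auto
  note pos = lam_bounds(1)[OF pI(1) \<open>n < d\<close>] lam_bounds(1)[OF pI(2) \<open>n < d\<close>]
  \<comment> \<open>The value 1/2 in the shared coordinates is an arbitrary interior one.\<close>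
  define z where "z c = (\<lambda>k. if k < n then 1/2 else if k = n then c else 0 :: real)" for c
  have z: "z c \<in> open_unit_cube (Suc n)" if "0 < c" "c < 1" for c
    using that by (auto simp: open_unit_cube_def z_def topspace_Euclidean_space)
  have "sponge_map lam t p (z ((x - t p) / lam p)) = sponge_map lam t p' (z ((x - t p') / lam p'))"
    using pos len by (auto simp: sponge_map_def z_def p_def p'_def fun_eq_iff less_Suc_eq)
  moreover have "z ((x - t p) / lam p) \<in> open_unit_cube (Suc n)"
    "z ((x - t p') / lam p') \<in> open_unit_cube (Suc n)"
    using x pos by (auto intro!: z simp: field_simps)
  ultimately have "sponge_map lam t p ` open_unit_cube (Suc n) \<inter>
      sponge_map lam t p' ` open_unit_cube (Suc n) \<noteq> {}" by blast
  moreover have "p \<noteq> p'" using assms by auto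
  ultimately show False
    using sponge pI \<open>n < d\<close>
    unfolding gatzouras_lalley_sponge_def cuboidal_open_set_condition_def by auto
qed

section \<open>Location of the attractor\<close>

lemma attractor_eq: "K = (\<Union>i\<in>I d. sponge_map lam t i ` K)"
  and attractor_nonempty: "K \<noteq> {}"
  and attractor_compactin: "compactin (Euclidean_space d) K"
  using sponge unfolding gatzouras_lalley_sponge_def is_attractor_def by auto

lemma attractor_subset_topspace: "K \<subseteq> topspace (Euclidean_space d)"
  by (rule compactin_subset_topspace[OF attractor_compactin])

text \<open>By compactness coordinate \<open>k\<close> attains its extrema on \<open>K\<close>. The
  minimum \<open>u k\<close> is the image of a value at least \<open>u k\<close> under a contraction
  of the line that preserves the unit interval, which forces \<open>u k\<close> to be nonnegative;
  the maximum is treated symmetrically.\<close>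

lemma attractor_in_cube:
  assumes "x \<in> K" "k < d"
  shows "0 \<le> x k" "x k \<le> 1"
proof -
  have "continuous_map (Euclidean_space d) euclideanreal (\<lambda>x. x k)"
    unfolding Euclidean_space_def
    by (intro continuous_map_from_subtopology continuous_map_product_projection) auto
  then have "compact ((\<lambda>x. x k) ` K)"
    using image_compactin[OF attractor_compactin, of euclideanreal] by auto
  then obtain u v where uv: "u \<in> K" "v \<in> K" "\<And>y. y \<in> K \<Longrightarrow> u k \<le> y k" "\<And>y. y \<in> K \<Longrightarrow> y k \<le> v k"
    using compact_attains_sup[of "(\<lambda>x. x k) ` K"] compact_attains_inf[of "(\<lambda>x. x k) ` K"]
      attractor_nonempty by auto
  \<comment> \<open>Coordinate \<open>k\<close> of an image depends only on coordinate
    \<open>k\<close> of the argument and on the prefix of length \<open>k + 1\<close>, so the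
    argument is one-dimensional.\<close>
  have step: "\<exists>z\<in>K. \<exists>i\<in>I (Suc k). y k = lam i * z k + t i" if "y \<in> K" for y
  proof -
    obtain i z where i: "i \<in> I d" "z \<in> K" "y = sponge_map lam t i z"
      using \<open>y \<in> K\<close> attractor_eq by blast
    then show ?thesis
      using assms(2) length_index_set[OF i(1)] take_index_set[OF i(1), of "Suc k"]
      by (auto simp: sponge_map_def)
  qed
  have "0 \<le> u k"
  proof -
    obtain z i where z: "z \<in> K" "i \<in> I (Suc k)" "u k = lam i * z k + t i"
      using step[OF uv(1)] by auto
    have "lam i * u k \<le> lam i * z k"
      using lam_bounds[OF z(2) assms(2)] uv(3)[OF z(1)] by simp
    then have "0 \<le> (1 - lam i) * u k"
      using z(3) translation_bounds[OF z(2) assms(2)] by (simp add: algebra_simps)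
    then show ?thesis using lam_bounds[OF z(2) assms(2)] by (simp add: zero_le_mult_iff)
  qed
  moreover have "v k \<le> 1"
  proof -
    obtain z i where z: "z \<in> K" "i \<in> I (Suc k)" "v k = lam i * z k + t i"
      using step[OF uv(2)] by auto
    have "lam i * z k \<le> lam i * v k"
      using lam_bounds[OF z(2) assms(2)] uv(4)[OF z(1)] by simp
    then have "0 \<le> (1 - lam i) * (1 - v k)"
      using z(3) translation_bounds[OF z(2) assms(2)] by (simp add: algebra_simps)
    then show ?thesis using lam_bounds[OF z(2) assms(2)] by (simp add: zero_le_mult_iff)
  qed
  ultimately show "0 \<le> x k" "x k \<le> 1" using uv(3,4)[OF assms(1)] by auto
qed

lemma ratio_bounds: "\<exists>q Q. 0 < q \<and> 0 < Q \<and> Q < 1 \<and>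
    (\<forall>n<d. \<forall>i\<in>I (Suc n). q \<le> lam i \<and> lam i \<le> Q)"
proof -
  \<comment> \<open>The element \<open>1/2\<close> keeps \<open>A\<close> nonempty when
    \<open>d = 0\<close>.\<close>
  define A where "A = insert (1/2) (\<Union>n<d. lam ` I (Suc n))"
  have A: "finite A" "A \<noteq> {}" by (auto simp: A_def finite_index_set)
  have "x \<in> A \<Longrightarrow> 0 < x \<and> x < 1" for x
    using lam_bounds unfolding A_def by fastforce
  then have "0 < Min A" "0 < Max A" "Max A < 1"
    using Min_in[OF A] Max_in[OF A] by auto
  moreover have "\<forall>n<d. \<forall>i\<in>I (Suc n). Min A \<le> lam i \<and> lam i \<le> Max A"
    using A(1) by (intro allI impI ballI conjI Min_le Max_ge) (force simp: A_def)+
  ultimately show ?thesis by blast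
qed

text \<open>Any positive lower bound for the ratios serves: a side longer than \<delta> cannot drop
  below \<open>qmin * \<delta>\<close> in one subdivision step.\<close>

definition qmin :: real where
  "qmin = (SOME q. 0 < q \<and> (\<forall>n<d. \<forall>i\<in>I (Suc n). q \<le> lam i))"

lemma qmin: "0 < qmin" "n < d \<Longrightarrow> i \<in> I (Suc n) \<Longrightarrow> qmin \<le> lam i"
proof -
  have "\<exists>q. 0 < q \<and> (\<forall>n<d. \<forall>i\<in>I (Suc n). q \<le> lam i)"
    using ratio_bounds by blast
  from someI_ex[OF this] show "0 < qmin" "n < d \<Longrightarrow> i \<in> I (Suc n) \<Longrightarrow> qmin \<le> lam i"
    unfolding qmin_def[symmetric] by auto
qed

section \<open>Cuboids and their subdivision at a given scale\<close>

text \<open>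
  The side lengths \<open>r\<close> of a cuboid in the subdivision at scale \<open>\<delta>\<close>; the coordinates below \<open>m\<close> are
  the ones still to be subdivided. Only these need to be ordered.
\<close>

definition valid_sides :: "real \<Rightarrow> nat \<Rightarrow> (nat \<Rightarrow> real) \<Rightarrow> bool" where
  "valid_sides \<delta> m r \<longleftrightarrow> m \<le> d \<and> (\<forall>l<m. \<delta> < r l) \<and>
     (\<forall>l<d. m \<le> l \<longrightarrow> qmin * \<delta> \<le> r l \<and> r l \<le> \<delta>) \<and> (\<forall>l. Suc l < m \<longrightarrow> r (Suc l) \<le> r l)"

definition child_side :: "nat \<Rightarrow> (nat \<Rightarrow> real) \<Rightarrow> nat list \<Rightarrow> nat \<Rightarrow> real" where
  "child_side m r i = (\<lambda>l. if l < m then r l * lam (take (Suc l) i) else r l)"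

definition child_corner ::
    "nat \<Rightarrow> (nat \<Rightarrow> real) \<Rightarrow> (nat \<Rightarrow> real) \<Rightarrow> nat list \<Rightarrow> nat \<Rightarrow> real" where
  "child_corner m a r i = (\<lambda>l. if l < m then a l + r l * t (take (Suc l) i) else a l)"

lemma valid_sides_pos: "valid_sides \<delta> m r \<Longrightarrow> 0 < \<delta> \<Longrightarrow> l < d \<Longrightarrow> 0 < r l"
  using qmin(1) unfolding valid_sides_def
  by (metis less_trans less_le_trans mult_pos_pos not_le)

text \<open>Both the old sides and the ratios decrease along the first \<open>m\<close> coordinates,
  hence so do the new sides. Those still longer than \<delta> thus form an initial segment, whose
  length is the new \<open>m'\<close>.\<close>

lemma valid_sides_child:
  assumes "valid_sides \<delta> m r" "0 < \<delta>" "i \<in> I m"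
  shows "\<exists>m'\<le>m. valid_sides \<delta> m' (child_side m r i)"
proof -
  let ?r = "child_side m r i"
  have m: "m \<le> d" using assms(1) by (simp add: valid_sides_def)
  note lam = lam_take_bounds[OF assms(3) m]
  have dec: "?r (Suc l) \<le> ?r l" if "Suc l < m" for l
    using that lam_ordered[OF assms(3) m that] lam[of l] lam[of "Suc l"] assms(1)
      valid_sides_pos[OF assms(1,2), of "Suc l"] m
    by (auto simp: child_side_def valid_sides_def intro!: mult_mono)
  \<comment> \<open>The first short side; the alternative \<open>k = m\<close> covers the case that
    no side has become short.\<close>
  define m' where "m' = (LEAST k. k = m \<or> ?r k \<le> \<delta>)"
  have m': "m' = m \<or> ?r m' \<le> \<delta>" unfolding m'_def by (rule LeastI[of _ m]) auto
  have "m' \<le> m" unfolding m'_def by (rule Least_le) auto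
  have gt: "\<delta> < ?r l" if "l < m'" for l
    using not_less_Least[OF that[unfolded m'_def]] by auto
  have "?r l \<le> \<delta>" if "m' \<le> l" "l < m" for l
    using that
  proof (induction l rule: dec_induct)
    case base then show ?case using m' by auto
  next
    case (step l) then show ?case using dec[of l] by auto
  qed
  moreover have "qmin * \<delta> \<le> ?r l" if "l < m" for l
  proof -
    have "qmin \<le> lam (take (Suc l) i)"
      using that m assms(3) by (auto intro!: qmin(2)[of l] take_index_set)
    then have "\<delta> * qmin \<le> r l * lam (take (Suc l) i)"
      using that assms(1,2) qmin(1) by (intro mult_mono) (auto simp: valid_sides_def intro: less_imp_le)
    then show ?thesis using that by (simp add: child_side_def mult.commute)
  qed
  ultimately have "qmin * \<delta> \<le> ?r l \<and> ?r l \<le> \<delta>" if "m' \<le> l" "l < d" for l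
    using that assms(1) by (cases "l < m") (auto simp: child_side_def valid_sides_def)
  then show ?thesis
    using \<open>m' \<le> m\<close> m gt dec by (intro exI[of _ m']) (auto simp: valid_sides_def)
qed

text \<open>Subdivision terminates because every split multiplies side 0, a longest one among those
  still active, by at most \<open>Q < 1\<close>.\<close>

lemma cuboid_induct [consumes 2, case_names leaf split]:
  assumes "valid_sides \<delta> m r" "0 < \<delta>"
    and leaf: "\<And>a r. valid_sides \<delta> 0 r \<Longrightarrow> P 0 a r"
    and split: "\<And>m a r. valid_sides \<delta> m r \<Longrightarrow> 0 < m \<Longrightarrow>
      (\<And>i m'. i \<in> I m \<Longrightarrow> m' \<le> m \<Longrightarrow> valid_sides \<delta> m' (child_side m r i) \<Longrightarrow>
        P m' (child_corner m a r i) (child_side m r i)) \<Longrightarrow> P m a r"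
  shows "P m a r"
proof -
  obtain Q where Q: "0 < Q" "Q < 1" "\<forall>n<d. \<forall>i\<in>I (Suc n). lam i \<le> Q"
    using ratio_bounds by blast
  \<comment> \<open>The induction is on a bound \<open>n\<close> for the remaining depth, since a
    split need not decrease \<open>m\<close>.\<close>
  have "P m a r" if "valid_sides \<delta> m r" "r 0 * Q ^ n \<le> \<delta>" for n m a r
    using that
  proof (induction n arbitrary: m a r)
    case 0
    then have "m = 0" unfolding valid_sides_def by fastforce
    then show ?case using leaf 0 by simp
  next
    case (Suc n)
    show ?case
    proof (cases "m = 0")
      case True
      then show ?thesis using leaf Suc by simp
    next
      case False
      show ?thesis
      proof (rule split[OF Suc.prems(1)])
        fix i m' assume i: "i \<in> I m" and "m' \<le> m" and v: "valid_sides \<delta> m' (child_side m r i)"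
        have m: "m \<le> d" using Suc.prems by (simp add: valid_sides_def)
        then have "take (Suc 0) i \<in> I (Suc 0)" using i False by (intro take_index_set) auto
        then have "lam (take (Suc 0) i) \<le> Q" using Q(3) False m by auto
        moreover have "0 < r 0" using valid_sides_pos[OF Suc.prems(1) assms(2)] False m by auto
        ultimately have "child_side m r i 0 * Q ^ n \<le> r 0 * Q * Q ^ n"
          using False Q(1) by (intro mult_right_mono) (simp_all add: child_side_def)
        also have "\<dots> \<le> \<delta>" using Suc.prems(2) by (simp add: mult.assoc)
        finally show "P m' (child_corner m a r i) (child_side m r i)" using Suc.IH[OF v] by simp
      qed (use False in simp)
    qed
  qed
  moreover have "\<exists>n. r 0 * Q ^ n \<le> \<delta>"
  proof -
    have "(\<lambda>n. r 0 * Q ^ n) \<longlonglongrightarrow> r 0 * 0"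
      using Q by (intro tendsto_intros LIMSEQ_power_zero) auto
    then have "eventually (\<lambda>n. r 0 * Q ^ n < \<delta>) sequentially"
      using assms(2) by (intro order_tendstoD(2)) auto
    then show ?thesis by (auto simp: eventually_sequentially intro: less_imp_le)
  qed
  ultimately show ?thesis using assms(1) by blast
qed

end

section \<open>Counting approximate squares\<close>

text \<open>A constant factor \<open>b\<close> contributes only
  \<open>ln b / (- ln \<delta>)\<close>, which vanishes in the limit.\<close>

lemma tendsto_log_ratio:
  fixes f :: "real \<Rightarrow> real"
  assumes "0 < c" "0 < C"
    and bounds: "\<And>\<delta>. 0 < \<delta> \<Longrightarrow> \<delta> < 1 \<Longrightarrow> c * \<delta> powr - s \<le> f \<delta> \<and> f \<delta> \<le> C * \<delta> powr - s"
  shows "((\<lambda>\<delta>. ln (f \<delta>) / (- ln \<delta>)) \<longlongrightarrow> s) (at_right 0)"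
proof -
  have "filterlim (\<lambda>\<delta>::real. - ln \<delta>) at_top (at_right 0)"
    using ln_at_0 by (simp add: filterlim_uminus_at_top)
  then have inf: "filterlim (\<lambda>\<delta>::real. - ln \<delta>) at_infinity (at_right 0)"
    by (rule filterlim_at_top_imp_at_infinity)
  have lim: "((\<lambda>\<delta>. s + ln b / (- ln \<delta>)) \<longlongrightarrow> s) (at_right 0)" for b :: real
    using tendsto_add[OF tendsto_const tendsto_divide_0[OF tendsto_const inf], of s "ln b"] by simp
  have ev: "eventually (\<lambda>\<delta>::real. 0 < \<delta> \<and> \<delta> < 1) (at_right 0)"
    by (rule eventually_at_rightI[of 0 1]) auto
  have ratio: "s + ln b / (- ln \<delta>) = ln (b * \<delta> powr - s) / (- ln \<delta>)"
    if "0 < \<delta>" "\<delta> < 1" "0 < b" for b \<delta>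
    using that by (simp add: ln_mult field_simps)
  have *: "s + ln c / (- ln \<delta>) \<le> ln (f \<delta>) / (- ln \<delta>) \<and> ln (f \<delta>) / (- ln \<delta>) \<le> s + ln C / (- ln \<delta>)"
    if \<delta>: "0 < \<delta>" "\<delta> < 1" for \<delta>
  proof -
    have "0 < c * \<delta> powr - s" using \<delta> assms(1) by simp
    then have "ln (c * \<delta> powr - s) \<le> ln (f \<delta>)" "ln (f \<delta>) \<le> ln (C * \<delta> powr - s)"
      using bounds[OF \<delta>] by (auto intro!: ln_mono)
    then show ?thesis
      unfolding ratio[OF \<delta> assms(1)] ratio[OF \<delta> assms(2)]
      using \<delta> by (intro conjI divide_right_mono) auto
  qed
  show ?thesis
    by (rule tendsto_sandwich[OF _ _ lim[of c] lim[of C]]; rule eventually_mono[OF ev]; use * in blast)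
qed

context sponge
begin

section \<open>Weights of words and the defining equations\<close>

text \<open>For a word of length \<open>n\<close> this is the summand of the n-th equation, with
  \<open>e l = s (l + 1) - s l\<close> and \<open>s 0 = 0\<close>. Of a longer word only the first
  \<open>n\<close> entries count.\<close>

definition weight :: "(nat \<Rightarrow> real) \<Rightarrow> nat \<Rightarrow> nat list \<Rightarrow> real" where
  "weight e n i = (\<Prod>l<n. lam (take (Suc l) i) powr e l)"

lemma weight_pos:
  assumes "i \<in> I m" "m \<le> d" "n \<le> m"
  shows "0 < weight e n i"
  unfolding weight_def
proof (rule prod_pos)
  fix l assume "l \<in> {..<n}"
  then show "0 < lam (take (Suc l) i) powr e l"
    using lam_take_bounds(1)[OF assms(1,2), of l] assms(3) by simp
qed

lemma weight_Suc: "i \<in> I (Suc n) \<Longrightarrow> weight e (Suc n) i = weight e n i * lam i powr e n"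
  using length_index_set[of i N "Suc n"] by (simp add: weight_def)

lemma weight_cong: "(\<And>l. l < n \<Longrightarrow> e l = e' l) \<Longrightarrow> weight e n i = weight e' n i"
  by (simp add: weight_def)

lemma weight_snoc: "i \<in> I n \<Longrightarrow> weight e n (i @ [j]) = weight e n i"
  using length_index_set[of i N n] by (simp add: weight_def)

text \<open>Every word has a child, so the old weights summed over the longer words still give at
  least 1. This makes the new exponent nonnegative and hence the sequence \<open>s\<close>
  nondecreasing.\<close>

lemma next_exponent:
  assumes "n < d" "(\<Sum>i\<in>I n. weight e n i) = 1"
  shows "\<exists>v\<ge>0. (\<Sum>i\<in>I (Suc n). weight e n i * lam i powr v) = 1"
    and "(\<Sum>i\<in>I (Suc n). weight e n i * lam i powr v) = 1 \<Longrightarrow>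
      (\<Sum>i\<in>I (Suc n). weight e n i * lam i powr w) = 1 \<Longrightarrow> v = w"
proof -
  have "1 = (\<Sum>i\<in>I n. weight e n i)" using assms(2) by simp
  also have "\<dots> \<le> (\<Sum>i\<in>I n. real (N i) * weight e n i)"
  proof (rule sum_mono)
    fix i assume i: "i \<in> I n"
    then have "1 \<le> real (N i)" "0 < weight e n i"
      using N_pos[OF i assms(1)] weight_pos[OF i, of n e] assms(1) by auto
    then show "weight e n i \<le> real (N i) * weight e n i" by simp
  qed
  also have "\<dots> = (\<Sum>i\<in>I (Suc n). weight e n i)"
    unfolding sum_index_set_Suc by (intro sum.cong refl) (simp add: weight_snoc)
  finally have *: "finite (I (Suc n))" "I (Suc n) \<noteq> {}" "\<And>i. i \<in> I (Suc n) \<Longrightarrow> 0 < weight e n i"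
    "\<And>i. i \<in> I (Suc n) \<Longrightarrow> 0 < lam i \<and> lam i < 1" "1 \<le> (\<Sum>i\<in>I (Suc n). weight e n i)"
    using finite_index_set index_set_nonempty[of "Suc n"] weight_pos[of _ "Suc n" n e]
      lam_bounds assms(1) by simp_all
  show "\<exists>v\<ge>0. (\<Sum>i\<in>I (Suc n). weight e n i * lam i powr v) = 1"
    by (rule unique_exponent(1)[OF *])
  show "(\<Sum>i\<in>I (Suc n). weight e n i * lam i powr v) = 1 \<Longrightarrow>
      (\<Sum>i\<in>I (Suc n). weight e n i * lam i powr w) = 1 \<Longrightarrow> v = w"
    by (rule unique_exponent(2)[OF *])
qed

lemma exponents_exist: "\<exists>e. (\<forall>l. 0 \<le> e l) \<and> (\<forall>k\<le>d. (\<Sum>i\<in>I k. weight e k i) = 1)"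
proof -
  have "\<exists>e. (\<forall>l. 0 \<le> e l) \<and> (\<forall>k\<le>n. (\<Sum>i\<in>I k. weight e k i) = 1)" if "n \<le> d" for n
    using that
  proof (induction n)
    case 0
    show ?case by (intro exI[of _ "\<lambda>_. 0"]) (simp add: weight_def)
  next
    case (Suc n)
    then obtain e where e: "\<And>l. 0 \<le> e l" "\<And>k. k \<le> n \<Longrightarrow> (\<Sum>i\<in>I k. weight e k i) = 1" by auto
    obtain v where v: "v \<ge> 0" "(\<Sum>i\<in>I (Suc n). weight e n i * lam i powr v) = 1"
      using next_exponent(1)[of n e] e(2) Suc.prems by auto
    \<comment> \<open>These weights read only the exponents below \<open>n\<close>, so the equations
      already solved survive the update.\<close>
    have eq: "weight (e(n := v)) k i = weight e k i" if "k \<le> n" for k i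
      using that by (intro weight_cong) auto
    have "(\<Sum>i\<in>I (Suc n). weight (e(n := v)) (Suc n) i) = 1"
      using v(2) eq[of n] by (simp add: weight_Suc cong: sum.cong)
    then show ?case
      using e v(1) eq
      by (intro exI[of _ "e(n := v)"]) (auto simp: le_Suc_eq simp del: fun_upd_apply, simp add: e(1))
  qed
  then show ?thesis by blast
qed

end

locale sponge_exponents = sponge +
  fixes e :: "nat \<Rightarrow> real"
  assumes e_nonneg: "0 \<le> e l"
    and sum_weight: "k \<le> d \<Longrightarrow> (\<Sum>i\<in>index_set N k. weight e k i) = 1"
begin

definition s :: "nat \<Rightarrow> real" where
  "s n = (\<Sum>l<n. e l)"

text \<open>Changing \<open>s n\<close> affects only the last factor of the n-th equation, which
  brings it into the form treated by \<open>next_exponent\<close>.\<close>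

lemma dimension_sum_eq:
  assumes "1 \<le> n"
  shows "dimension_sum N lam (s(n := u)) n = (\<Sum>i\<in>I n. weight e (n - 1) i * lam i powr (u - s (n - 1)))"
  unfolding dimension_sum_def
proof (rule sum.cong)
  fix i assume i: "i \<in> I n"
  define s' where "s' = s(n := u)"
  \<comment> \<open>With this value the separate first factor becomes the term \<open>l = 1\<close>
    of the product.\<close>
  have "s' 0 = 0" using assms by (simp add: s'_def s_def)
  then have "lam (take 1 i) powr s' 1 * (\<Prod>l=2..n. lam (take l i) powr (s' l - s' (l - 1))) =
      (\<Prod>l=1..n. lam (take l i) powr (s' l - s' (l - 1)))"
    using prod.atLeast_Suc_atMost[OF assms, of "\<lambda>l. lam (take l i) powr (s' l - s' (l - 1))"]
    by (simp add: numeral_2_eq_2)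
  also have "\<dots> = (\<Prod>l<n. lam (take (Suc l) i) powr (s' (Suc l) - s' l))"
    by (simp add: prod.atLeast1_atMost_eq)
  also have "\<dots> = (\<Prod>l<n - 1. lam (take (Suc l) i) powr (s' (Suc l) - s' l)) * lam i powr (u - s (n - 1))"
    using assms length_index_set[OF i] by (cases n) (simp_all add: s'_def)
  also have "(\<Prod>l<n - 1. lam (take (Suc l) i) powr (s' (Suc l) - s' l)) = weight e (n - 1) i"
    unfolding weight_def by (intro prod.cong) (auto simp: s'_def s_def)
  finally show "lam (take 1 i) powr (s(n := u)) 1 *
      (\<Prod>l=2..n. lam (take l i) powr ((s(n := u)) l - (s(n := u)) (l - 1))) =
      weight e (n - 1) i * lam i powr (u - s (n - 1))"
    unfolding s'_def .
qed simp

lemma successive_unique_solutions: "successive_unique_solutions d N lam s"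
  unfolding successive_unique_solutions_def
proof (intro ballI)
  fix n assume n: "n \<in> {1..d}"
  then obtain k where k: "n = Suc k" "k < d" by (cases n) auto
  have eq: "dimension_sum N lam (s(n := u)) n = (\<Sum>i\<in>I (Suc k). weight e k i * lam i powr (u - s k))" for u
    using dimension_sum_eq[of n u] k by simp
  have *: "(\<Sum>i\<in>I (Suc k). weight e k i * lam i powr (s n - s k)) = 1"
    using sum_weight[of n] k by (simp add: s_def weight_Suc cong: sum.cong)
  have "\<exists>!u. dimension_sum N lam (s(n := u)) n = 1"
  proof (rule ex1I[of _ "s n"])
    fix u assume "dimension_sum N lam (s(n := u)) n = 1"
    then have "u - s k = s n - s k"
      using next_exponent(2)[OF k(2) sum_weight _ *] k(2) unfolding eq by simp
    then show "u = s n" by simp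
  qed (use eq[of "s n"] * in simp_all)
  then show "dimension_sum N lam s n = 1 \<and> (\<exists>!u. dimension_sum N lam (s(n := u)) n = 1)"
    using eq[of "s n"] * by simp
qed

section \<open>Weights of cuboids\<close>

definition cuboid_weight :: "(nat \<Rightarrow> real) \<Rightarrow> real" where
  "cuboid_weight r = (\<Prod>l<d. r l powr e l)"

lemma prod_split_at: "m \<le> d \<Longrightarrow> (\<Prod>l<d. f l :: real) = (\<Prod>l<m. f l) * (\<Prod>l\<in>{m..<d}. f l)"
  by (subst prod.union_disjoint[symmetric]) (auto intro: prod.cong)

text \<open>Only the first \<open>m\<close> sides change, so a child has \<open>weight e m i\<close>
  times the weight of its parent, and these factors sum to 1 by the m-th equation.\<close>

lemma sum_child_weight:
  assumes "valid_sides \<delta> m r" "0 < \<delta>"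
  shows "(\<Sum>i\<in>I m. cuboid_weight (child_side m r i)) = cuboid_weight r"
proof -
  have m: "m \<le> d" using assms by (simp add: valid_sides_def)
  have "cuboid_weight (child_side m r i) = weight e m i * cuboid_weight r" if i: "i \<in> I m" for i
  proof -
    have "(\<Prod>l<m. child_side m r i l powr e l) = (\<Prod>l<m. r l powr e l) * weight e m i"
      unfolding weight_def prod.distrib[symmetric]
    proof (intro prod.cong refl)
      fix l assume "l \<in> {..<m}"
      then show "child_side m r i l powr e l = r l powr e l * lam (take (Suc l) i) powr e l"
        using valid_sides_pos[OF assms, of l] lam_take_bounds[OF i m, of l] m
        by (simp add: child_side_def powr_mult)
    qed
    moreover have "(\<Prod>l\<in>{m..<d}. child_side m r i l powr e l) = (\<Prod>l\<in>{m..<d}. r l powr e l)"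
      by (intro prod.cong) (auto simp: child_side_def)
    ultimately show ?thesis
      unfolding cuboid_weight_def prod_split_at[OF m] by simp
  qed
  then have "(\<Sum>i\<in>I m. cuboid_weight (child_side m r i)) = (\<Sum>i\<in>I m. weight e m i) * cuboid_weight r"
    unfolding sum_distrib_right by (intro sum.cong) auto
  then show ?thesis using sum_weight[OF m] by simp
qed

text \<open>All sides of a leaf lie between \<open>qmin * \<delta>\<close> and \<delta>; as the
  exponents are nonnegative and add up to \<open>s d\<close>, the product can be compared factor by
  factor.\<close>

lemma leaf_weight_bounds:
  assumes "valid_sides \<delta> 0 r" "0 < \<delta>"
  shows "(qmin * \<delta>) powr s d \<le> cuboid_weight r" "cuboid_weight r \<le> \<delta> powr s d"
proof -
  have pow: "x powr s d = (\<Prod>l<d. x powr e l)" if "x > 0" for x :: real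
    unfolding s_def using that by (simp add: powr_sum)
  have pos: "0 < qmin * \<delta>" using assms(2) qmin(1) by simp
  have r: "0 < r l" "qmin * \<delta> \<le> r l" "r l \<le> \<delta>" if "l < d" for l
    using assms(1) valid_sides_pos[OF assms that] that by (auto simp: valid_sides_def)
  show "(qmin * \<delta>) powr s d \<le> cuboid_weight r"
    unfolding cuboid_weight_def pow[OF pos]
    using r pos e_nonneg by (intro prod_mono) (simp add: powr_mono2)
  show "cuboid_weight r \<le> \<delta> powr s d"
    unfolding cuboid_weight_def pow[OF assms(2)]
    using r e_nonneg by (intro prod_mono) (simp add: powr_mono2 less_imp_le)
qed

section \<open>Upper bound: covering the attractor\<close>

text \<open>
  The affine copy of the attractor in the first \<open>m\<close> coordinates, thickened to full intervals in the
  others.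
\<close>

definition piece :: "nat \<Rightarrow> (nat \<Rightarrow> real) \<Rightarrow> (nat \<Rightarrow> real) \<Rightarrow> (nat \<Rightarrow> real) set" where
  "piece m a r = {x \<in> topspace (Euclidean_space d). \<exists>y\<in>K. \<forall>l<d.
     if l < m then x l = a l + r l * y l else a l \<le> x l \<and> x l \<le> a l + r l}"

lemma piece_children:
  assumes "valid_sides \<delta> m r" "0 < \<delta>" "x \<in> piece m a r"
  shows "\<exists>i\<in>I m. x \<in> piece m (child_corner m a r i) (child_side m r i)"
proof -
  obtain y where y: "y \<in> K" "\<And>l. l < d \<Longrightarrow>
      if l < m then x l = a l + r l * y l else a l \<le> x l \<and> x l \<le> a l + r l"
    using assms(3) unfolding piece_def by blast
  obtain i z where i: "i \<in> I d" "z \<in> K" "y = sponge_map lam t i z"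
    using y(1) attractor_eq by blast
  have m: "m \<le> d" using assms by (simp add: valid_sides_def)
  have "if l < m then x l = child_corner m a r (take m i) l + child_side m r (take m i) l * z l
      else child_corner m a r (take m i) l \<le> x l \<and>
        x l \<le> child_corner m a r (take m i) l + child_side m r (take m i) l" if "l < d" for l
    using y(2)[OF that] that m i(3) length_index_set[OF i(1)]
    by (auto simp: child_corner_def child_side_def sponge_map_def min_def algebra_simps)
  then have "x \<in> piece m (child_corner m a r (take m i)) (child_side m r (take m i))"
    using assms(3) i(2) unfolding piece_def by blast
  then show ?thesis using take_index_set[OF i(1) m] by blast
qed

lemma coordinate_in_side:
  assumes "y \<in> K" "l < d" "0 < \<rho>"
  shows "a \<le> a + \<rho> * y l" "a + \<rho> * y l \<le> a + \<rho>"
  using attractor_in_cube[OF assms(1,2)] assms(3) by (simp_all add: mult_left_le)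

text \<open>When a child has fewer long sides than its parent, the coordinates that became short are
  relaxed to full intervals; this only enlarges the piece, since \<open>K\<close> lies in the unit
  cube.\<close>

lemma piece_mono:
  assumes "valid_sides \<delta> m' r" "0 < \<delta>" "m' \<le> m"
  shows "piece m a r \<subseteq> piece m' a r"
proof
  fix x assume "x \<in> piece m a r"
  then obtain y where y: "x \<in> topspace (Euclidean_space d)" "y \<in> K" "\<And>l. l < d \<Longrightarrow>
      if l < m then x l = a l + r l * y l else a l \<le> x l \<and> x l \<le> a l + r l"
    unfolding piece_def by blast
  have "if l < m' then x l = a l + r l * y l else a l \<le> x l \<and> x l \<le> a l + r l" if "l < d" for l
    using y(3)[OF that] assms(3)
      coordinate_in_side[OF y(2) that valid_sides_pos[OF assms(1,2) that], of "a l"]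
    by (auto split: if_splits)
  then show "x \<in> piece m' a r" unfolding piece_def using y(1,2) by blast
qed

abbreviation boxes :: "real \<Rightarrow> (nat \<Rightarrow> real) set set" where
  "boxes \<delta> \<equiv> coordinate_box d \<delta> ` topspace (Euclidean_space d)"

text \<open>Each leaf needs one box and has weight at least
  \<open>(qmin * \<delta>) powr s d\<close>; additivity of the weight passes the bound up to the
  parents.\<close>

lemma piece_cover:
  assumes "valid_sides \<delta> m r" "0 < \<delta>"
  shows "\<exists>C. finite C \<and> C \<subseteq> boxes \<delta> \<and> piece m a r \<subseteq> \<Union>C \<and>
    real (card C) * (qmin * \<delta>) powr s d \<le> cuboid_weight r"
  using assms
proof (induction m a r rule: cuboid_induct)
  case (leaf a r)
  \<comment> \<open>Setting the coordinates from \<open>d\<close> on to 0 turns the corner into a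
    point of the space.\<close>
  define b where "b l = (if l < d then a l else 0)" for l
  have "b \<in> topspace (Euclidean_space d)" by (auto simp: b_def topspace_Euclidean_space)
  moreover have "piece 0 a r \<subseteq> coordinate_box d \<delta> b"
    using leaf by (fastforce simp: piece_def coordinate_box_def b_def valid_sides_def)
  ultimately show ?case
    using leaf_weight_bounds(1)[OF leaf(1) assms(2)]
    by (intro exI[of _ "{coordinate_box d \<delta> b}"]) auto
next
  case (split m a r)
  have "\<exists>C. finite C \<and> C \<subseteq> boxes \<delta> \<and> piece m (child_corner m a r i) (child_side m r i) \<subseteq> \<Union>C \<and>
      real (card C) * (qmin * \<delta>) powr s d \<le> cuboid_weight (child_side m r i)" if i: "i \<in> I m" for i
  proof -
    obtain m' where m': "m' \<le> m" "valid_sides \<delta> m' (child_side m r i)"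
      using valid_sides_child[OF split(1) assms(2) i] by blast
    then show ?thesis
      using split(3)[OF i m'] piece_mono[OF m'(2) assms(2) m'(1), of "child_corner m a r i"]
      by (meson order_trans)
  qed
  then obtain C where C: "\<And>i. i \<in> I m \<Longrightarrow> finite (C i)" "\<And>i. i \<in> I m \<Longrightarrow> C i \<subseteq> boxes \<delta>"
    "\<And>i. i \<in> I m \<Longrightarrow> piece m (child_corner m a r i) (child_side m r i) \<subseteq> \<Union>(C i)"
    "\<And>i. i \<in> I m \<Longrightarrow> real (card (C i)) * (qmin * \<delta>) powr s d \<le> cuboid_weight (child_side m r i)"
    by metis
  have "real (card (\<Union>i\<in>I m. C i)) \<le> (\<Sum>i\<in>I m. real (card (C i)))"
    unfolding of_nat_sum[symmetric] of_nat_le_iff by (rule card_UN_le[OF finite_index_set])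
  then have "real (card (\<Union>i\<in>I m. C i)) * (qmin * \<delta>) powr s d \<le>
      (\<Sum>i\<in>I m. real (card (C i)) * (qmin * \<delta>) powr s d)"
    unfolding sum_distrib_right[symmetric] by (intro mult_right_mono) auto
  also have "\<dots> \<le> (\<Sum>i\<in>I m. cuboid_weight (child_side m r i))"
    using C(4) by (rule sum_mono)
  also have "\<dots> = cuboid_weight r" by (rule sum_child_weight[OF split(1) assms(2)])
  finally have "real (card (\<Union>i\<in>I m. C i)) * (qmin * \<delta>) powr s d \<le> cuboid_weight r" .
  moreover have "piece m a r \<subseteq> \<Union>(\<Union>i\<in>I m. C i)"
    using piece_children[OF split(1) assms(2)] C(3) by blast
  moreover have "finite (\<Union>i\<in>I m. C i)" "(\<Union>i\<in>I m. C i) \<subseteq> boxes \<delta>"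
    using C(1,2) finite_index_set by blast+
  ultimately show ?case by blast
qed

section \<open>Lower bound: comparing weight with volume\<close>

text \<open>
  Quantifying over all \<open>y\<close> makes the condition \<open>K \<inter> cuboid \<noteq> {}\<close> inductive.
\<close>

definition occupied :: "nat \<Rightarrow> (nat \<Rightarrow> real) \<Rightarrow> (nat \<Rightarrow> real) \<Rightarrow> bool" where
  "occupied m a r \<longleftrightarrow> (\<forall>y\<in>K. \<exists>x\<in>K. \<forall>l<d.
     if l < m then x l = a l + r l * y l else a l \<le> x l \<and> x l \<le> a l + r l)"

text \<open>The condition on the parent is applied to the image of \<open>y\<close> under the map of
  a full word extending \<open>i\<close>; composing the two affine maps gives the child's.\<close>

lemma occupied_child:
  assumes "valid_sides \<delta> m r" "0 < \<delta>" "occupied m a r" "i \<in> I m" "m' \<le> m"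
    and v: "valid_sides \<delta> m' (child_side m r i)"
  shows "occupied m' (child_corner m a r i) (child_side m r i)"
  unfolding occupied_def
proof
  fix y assume y: "y \<in> K"
  have m: "m \<le> d" using assms by (simp add: valid_sides_def)
  obtain i' where i': "i' \<in> I d" "take m i' = i" using extend_index[OF assms(4) m] by auto
  then have "sponge_map lam t i' y \<in> K" using attractor_eq y by blast
  then obtain x where x: "x \<in> K" "\<And>l. l < d \<Longrightarrow> if l < m then x l = a l + r l * sponge_map lam t i' y l
      else a l \<le> x l \<and> x l \<le> a l + r l"
    using assms(3) unfolding occupied_def by blast
  have tk: "take (Suc l) i' = take (Suc l) i" if "l < m" for l
    using that i'(2) by (auto simp: min_def)
  have "if l < m' then x l = child_corner m a r i l + child_side m r i l * y l
      else child_corner m a r i l \<le> x l \<and> x l \<le> child_corner m a r i l + child_side m r i l"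
    if "l < d" for l
  proof (cases "l < m")
    case True
    have "x l = child_corner m a r i l + child_side m r i l * y l"
      using x(2)[OF that] True that length_index_set[OF i'(1)] tk[OF True]
      by (simp add: child_corner_def child_side_def sponge_map_def algebra_simps)
    then show ?thesis
      using coordinate_in_side[OF y that valid_sides_pos[OF v assms(2) that]] by simp
  next
    case False
    then show ?thesis using x(2)[OF that] assms(5) by (simp add: child_corner_def child_side_def)
  qed
  then show "\<exists>x\<in>K. \<forall>l<d. if l < m' then x l = child_corner m a r i l + child_side m r i l * y l
      else child_corner m a r i l \<le> x l \<and> x l \<le> child_corner m a r i l + child_side m r i l"
    using x(1) by blast
qed

text \<open>The volume of the part of the open cuboid inside the box at \<open>b\<close> enlarged by
  \<delta> on every side, written as a product of lengths so that only measure on the line is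
  involved.\<close>

definition cuboid_overlap :: "real \<Rightarrow> (nat \<Rightarrow> real) \<Rightarrow> (nat \<Rightarrow> real) \<Rightarrow> (nat \<Rightarrow> real) \<Rightarrow> real" where
  "cuboid_overlap \<delta> a r b = (\<Prod>l<d. overlap \<delta> (a l) (r l) (b l))"

lemma sum_sibling_overlap_le:
  assumes "i \<in> I k" "k < d" "0 < \<rho>"
  shows "(\<Sum>j\<in>{1..N i}. overlap \<delta> (a + \<rho> * t (i @ [j])) (\<rho> * lam (i @ [j])) b) \<le> overlap \<delta> a \<rho> b"
proof (rule sum_overlap_le)
  fix j assume "j \<in> {1..N i}"
  then have j: "i @ [j] \<in> I (Suc k)" using assms(1) by auto
  show "{t (i @ [j])<..<t (i @ [j]) + lam (i @ [j])} \<subseteq> {0<..<1}"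
    using translation_bounds[OF j assms(2)] by auto
next
  fix j j' assume "j \<in> {1..N i}" "j' \<in> {1..N i}" "j \<noteq> j'"
  then show "{t (i @ [j])<..<t (i @ [j]) + lam (i @ [j])} \<inter>
      {t (i @ [j'])<..<t (i @ [j']) + lam (i @ [j'])} = {}"
    by (rule siblings_disjoint[OF assms(1,2)])
qed (use assms in auto)

text \<open>Coordinate by coordinate, the overlaps of siblings add up to at most that of the parent
  interval, whatever the earlier symbols are.\<close>

lemma sum_child_overlap_le:
  assumes "valid_sides \<delta> m r" "0 < \<delta>"
  shows "(\<Sum>i\<in>I m. cuboid_overlap \<delta> (child_corner m a r i) (child_side m r i) b) \<le>
    cuboid_overlap \<delta> a r b"
proof -
  have m: "m \<le> d" using assms by (simp add: valid_sides_def)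
  define g where "g l j = overlap \<delta> (a l + r l * t j) (r l * lam j) (b l)" for l j
  define R where "R = (\<Prod>l\<in>{m..<d}. overlap \<delta> (a l) (r l) (b l))"
  have "cuboid_overlap \<delta> (child_corner m a r i) (child_side m r i) b =
      (\<Prod>l<m. g l (take (Suc l) i)) * R" for i
  proof -
    have "(\<Prod>l\<in>{m..<d}. overlap \<delta> (child_corner m a r i l) (child_side m r i l) (b l)) = R"
      unfolding R_def by (intro prod.cong) (auto simp: child_corner_def child_side_def)
    then show ?thesis
      unfolding cuboid_overlap_def prod_split_at[OF m]
      by (simp add: child_corner_def child_side_def g_def)
  qed
  then have "(\<Sum>i\<in>I m. cuboid_overlap \<delta> (child_corner m a r i) (child_side m r i) b) =
      (\<Sum>i\<in>I m. \<Prod>l<m. g l (take (Suc l) i)) * R"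
    by (simp add: sum_distrib_right)
  also have "\<dots> \<le> (\<Prod>l<m. overlap \<delta> (a l) (r l) (b l)) * R"
  proof (intro mult_right_mono sum_index_set_prod_le)
    fix k i assume "k < m" "i \<in> I k"
    then show "(\<Sum>j\<in>{1..N i}. g k (i @ [j])) \<le> overlap \<delta> (a k) (r k) (b k)"
      unfolding g_def using m valid_sides_pos[OF assms, of k]
      by (intro sum_sibling_overlap_le[of _ k]) auto
  qed (auto simp: g_def R_def overlap_nonneg intro!: prod_nonneg)
  also have "\<dots> = cuboid_overlap \<delta> a r b"
    unfolding cuboid_overlap_def prod_split_at[OF m] R_def ..
  finally show ?thesis .
qed

text \<open>An occupied leaf shares a point with some box of the cover. Its sides are at most
  \<delta>, so it lies inside the enlarged box and its overlap is its full volume. At a split the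
  weight is additive, while the overlaps of the children add up to at most that of the
  parent.\<close>

lemma weight_le_overlap:
  assumes "valid_sides \<delta> m r" "0 < \<delta>" "occupied m a r"
    and A: "finite A" "K \<subseteq> (\<Union>b\<in>A. coordinate_box d \<delta> b)"
  shows "cuboid_weight r * (qmin * \<delta>) ^ d \<le> \<delta> powr s d * (\<Sum>b\<in>A. cuboid_overlap \<delta> a r b)"
  using assms(1-3)
proof (induction m a r rule: cuboid_induct)
  case (leaf a r)
  obtain y where "y \<in> K" using attractor_nonempty by blast
  then obtain x where x: "x \<in> K" "\<And>l. l < d \<Longrightarrow> a l \<le> x l \<and> x l \<le> a l + r l"
    using leaf(2) unfolding occupied_def by fastforce
  then obtain b where b: "b \<in> A" "x \<in> coordinate_box d \<delta> b" using A(2) by blast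
  have r: "qmin * \<delta> \<le> r l" "r l \<le> \<delta>" if "l < d" for l
    using leaf(1) that by (auto simp: valid_sides_def)
  have "overlap \<delta> (a l) (r l) (b l) = r l" if "l < d" for l
  proof (rule overlap_full)
    have "b l \<le> x l" "x l \<le> b l + \<delta>" using b(2) that by (auto simp: coordinate_box_def)
    then show "b l - \<delta> \<le> a l" "a l + r l \<le> b l + 2 * \<delta>" using x(2)[OF that] r[OF that] by auto
    show "0 \<le> r l" using valid_sides_pos[OF leaf(1) assms(2) that] by simp
  qed
  then have "(\<Prod>l<d. qmin * \<delta>) \<le> cuboid_overlap \<delta> a r b"
    unfolding cuboid_overlap_def using r(1) qmin(1) assms(2) by (intro prod_mono) auto
  also have "\<dots> \<le> (\<Sum>b\<in>A. cuboid_overlap \<delta> a r b)"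
    using A(1) b(1) by (intro member_le_sum) (auto simp: cuboid_overlap_def overlap_nonneg prod_nonneg)
  finally show ?case
    using leaf_weight_bounds(2)[OF leaf(1) assms(2)] qmin(1) assms(2)
    by (intro mult_mono) auto
next
  case (split m a r)
  have "cuboid_weight r * (qmin * \<delta>) ^ d =
      (\<Sum>i\<in>I m. cuboid_weight (child_side m r i) * (qmin * \<delta>) ^ d)"
    unfolding sum_distrib_right[symmetric] sum_child_weight[OF split(1) assms(2)] ..
  also have "\<dots> \<le> (\<Sum>i\<in>I m. \<delta> powr s d *
      (\<Sum>b\<in>A. cuboid_overlap \<delta> (child_corner m a r i) (child_side m r i) b))"
  proof (rule sum_mono)
    fix i assume i: "i \<in> I m"
    obtain m' where m': "m' \<le> m" "valid_sides \<delta> m' (child_side m r i)"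
      using valid_sides_child[OF split(1) assms(2) i] by blast
    show "cuboid_weight (child_side m r i) * (qmin * \<delta>) ^ d \<le>
        \<delta> powr s d * (\<Sum>b\<in>A. cuboid_overlap \<delta> (child_corner m a r i) (child_side m r i) b)"
      by (rule split(3)[OF i m' occupied_child[OF split(1) assms(2) split(4) i m']])
  qed
  also have "\<dots> = \<delta> powr s d *
      (\<Sum>b\<in>A. \<Sum>i\<in>I m. cuboid_overlap \<delta> (child_corner m a r i) (child_side m r i) b)"
    unfolding sum_distrib_left[symmetric] by (subst sum.swap) (rule refl)
  also have "\<dots> \<le> \<delta> powr s d * (\<Sum>b\<in>A. cuboid_overlap \<delta> a r b)"
    by (intro mult_left_mono sum_mono sum_child_overlap_le[OF split(1) assms(2)]) simp
  finally show ?case .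
qed

text \<open>Both estimates are applied to the unit cube, of weight 1. For the lower one, each box of
  an optimal cover has overlap at most \<open>(3 * \<delta>) ^ d\<close>, and the factor
  \<open>\<delta> ^ d\<close> cancels.\<close>

lemma covering_number_bounds:
  assumes \<delta>: "0 < \<delta>" "\<delta> < 1"
  shows "(qmin / 3) ^ d * \<delta> powr - s d \<le> covering_number d \<delta> K"
    and "covering_number d \<delta> K \<le> qmin powr - s d * \<delta> powr - s d"
proof -
  have v: "valid_sides \<delta> d (\<lambda>_. 1)" using \<delta> by (auto simp: valid_sides_def)
  have w: "cuboid_weight (\<lambda>_. 1) = 1" by (simp add: cuboid_weight_def)
  have "K \<subseteq> piece d (\<lambda>_. 0) (\<lambda>_. 1)"
    using attractor_subset_topspace by (auto simp: piece_def)
  then obtain C where C: "finite C" "C \<subseteq> boxes \<delta>" "K \<subseteq> \<Union>C"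
      "real (card C) * (qmin * \<delta>) powr s d \<le> 1"
    using piece_cover[OF v \<delta>(1), of "\<lambda>_. 0"] unfolding w by (meson order_trans)
  then have "covering_number d \<delta> K \<le> card C"
    unfolding covering_number_def by (intro Least_le) blast
  then have "real (covering_number d \<delta> K) \<le> card C" by simp
  also have "\<dots> \<le> qmin powr - s d * \<delta> powr - s d"
    using C(4) \<delta>(1) qmin(1) by (simp add: powr_mult powr_minus field_simps)
  finally show "covering_number d \<delta> K \<le> qmin powr - s d * \<delta> powr - s d" .

  have "\<exists>C. finite C \<and> card C = covering_number d \<delta> K \<and> C \<subseteq> boxes \<delta> \<and> K \<subseteq> \<Union>C"
    unfolding covering_number_def by (rule LeastI[of _ "card C"]) (use C in blast)
  then obtain D where D: "finite D" "card D = covering_number d \<delta> K" "D \<subseteq> boxes \<delta>" "K \<subseteq> \<Union>D"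
    by blast
  \<comment> \<open>One corner is chosen per box, so that sums over \<open>A\<close> have exactly
    \<open>covering_number d \<delta> K\<close> terms.\<close>
  then obtain A where A: "inj_on (coordinate_box d \<delta>) A" "D = coordinate_box d \<delta> ` A"
    unfolding subset_image_inj by blast
  then have cA: "finite A" "card A = covering_number d \<delta> K" "K \<subseteq> (\<Union>b\<in>A. coordinate_box d \<delta> b)"
    using D by (auto simp: card_image finite_image_iff)
  have "occupied d (\<lambda>_. 0) (\<lambda>_. 1)" by (auto simp: occupied_def)
  from weight_le_overlap[OF v \<delta>(1) this cA(1,3)]
  have "(qmin * \<delta>) ^ d \<le> \<delta> powr s d * (\<Sum>b\<in>A. cuboid_overlap \<delta> (\<lambda>_. 0) (\<lambda>_. 1) b)"
    by (simp add: w)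
  also have "\<dots> \<le> \<delta> powr s d * (\<Sum>b\<in>A. (3 * \<delta>) ^ d)"
  proof (intro mult_left_mono sum_mono)
    fix b :: "nat \<Rightarrow> real"
    have "cuboid_overlap \<delta> (\<lambda>_. 0) (\<lambda>_. 1) b \<le> (\<Prod>l<d. 3 * \<delta>)"
      unfolding cuboid_overlap_def
      using overlap_nonneg overlap_le[OF \<delta>(1)] by (intro prod_mono) auto
    then show "cuboid_overlap \<delta> (\<lambda>_. 0) (\<lambda>_. 1) b \<le> (3 * \<delta>) ^ d" by simp
  qed simp
  finally have "qmin ^ d * \<delta> ^ d \<le> (\<delta> powr s d * covering_number d \<delta> K * 3 ^ d) * \<delta> ^ d"
    using cA(2) by (simp add: power_mult_distrib mult_ac)
  then have "qmin ^ d \<le> \<delta> powr s d * covering_number d \<delta> K * 3 ^ d"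
    using \<delta>(1) by simp
  then show "(qmin / 3) ^ d * \<delta> powr - s d \<le> covering_number d \<delta> K"
    using \<delta>(1) by (simp add: power_divide powr_minus field_simps)
qed

lemma has_box_dimension: "has_box_dimension d K (s d)"
  unfolding has_box_dimension_def
proof (intro conjI attractor_subset_topspace)
  show "\<exists>R. \<forall>x\<in>K. \<forall>k<d. \<bar>x k\<bar> \<le> R"
    using attractor_in_cube by (intro exI[of _ 1]) auto
  show "((\<lambda>\<delta>. ln (real (covering_number d \<delta> K)) / - ln \<delta>) \<longlongrightarrow> s d) (at_right 0)"
    using covering_number_bounds qmin(1)
    by (intro tendsto_log_ratio[of "(qmin / 3) ^ d" "qmin powr - s d"]) auto
qed

end

theorem theorem2p3:
  fixes d :: nat and N :: "nat list \<Rightarrow> nat" and lam t :: "nat list \<Rightarrow> real"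
    and K :: "(nat \<Rightarrow> real) set"
  assumes "d \<ge> 1"
    and "gatzouras_lalley_sponge d N lam t K"
  shows "\<exists>s :: nat \<Rightarrow> real.
           successive_unique_solutions d N lam s \<and>
           (\<forall>n\<in>{1..<d}. s n \<le> s (Suc n)) \<and>
           has_box_dimension d K (s d)"
proof -
  interpret sponge d N lam t K by unfold_locales (fact assms(2))
  obtain e where e: "\<forall>l. 0 \<le> e l" "\<forall>k\<le>d. (\<Sum>i\<in>I k. weight e k i) = 1"
    using exponents_exist by blast
  interpret sponge_exponents d N lam t K e by unfold_locales (use e in auto)
  show ?thesis
    using successive_unique_solutions has_box_dimension e_nonneg
    by (intro exI[of _ s]) (auto simp: s_def)
qed

end
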